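(* Let $V_1,\dots,V_4$, $p_1,\dots,p_4$ be the data of a string segment in $AdS_3$ satisfying the causality conditions (see context), let $N_a=\frac{\epsilon_{abcd}V_1^bp_1^cp_4^d}{p_1\cdot p_4}$ be its normal vector, and write $N^\pm=N^1\pm N^{-1}$, $N=N^0+N^2$, $\overline N=N^0-N^2$ (so that $N^+N^--N\overline N=L^2$). Then the light cone coordinates $(a_j,\bar a_j)$, $j=1,2,3,4$, of the boundary points of the segment satisfy $$N^-\bar a_ja_j-N\bar a_jL-\overline Na_jL+N^+L^2=0 .$$ Consequently: if $N^-=0$, the four boundary points lie on a straight timelike line (the time axis of an inertial frame) of $\mathbb{R}^{1,1}$, with equation $N\bar a+\overline Na=N^+L$; if $N^-\neq0$, they lie on the hyperbola $$-(\bar a-\bar a_0)(a-a_0)=\varrho^2,\qquad a_0=L\frac{N}{N^-},\quad \bar a_0=L\frac{\overline N}{N^-},\quad \varrho=\frac{L^2}{|N^-|},$$ which is the world line of motion with constant acceleration $g=\frac{|N^-|}{L^2}$.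
   Context: $\mathbb{R}^{2,2}$ has coordinates $X^{-1},X^0,X^1,X^2$ and bilinear form $X\cdot Y=-X^{-1}Y^{-1}-X^0Y^0+X^1Y^1+X^2Y^2$; indices are raised and lowered with this form, $\epsilon_{abcd}$ is the Levi-Civita symbol, and $X^\pm=X^1\pm X^{-1}$. $AdS_3=\{X: X\cdot X=-L^2\}$ with $L>0$. A string segment is given by $V_1\in AdS_3$ and null vectors $p_1,p_4\in\mathbb{R}^{2,2}$ with $p_1\cdot V_1=p_4\cdot V_1=0$; its vertices are $V_1$, $V_2=V_1+p_1$, $V_4=V_1+p_4$ and $$V_3=\frac{L^2+\frac12p_1\cdot p_4}{L^2-\frac12p_1\cdot p_4}V_1+\frac{L^2}{L^2-\frac12p_1\cdot p_4}(p_1+p_4),$$ and $p_2=V_3-V_2$, $p_3=V_3-V_4$. Boundary points (assuming $p_i^-\neq0$): $x_i=(t_i,x_i^1)=\frac{L}{p_i^-}(p_i^0,p_i^2)\in\mathbb{R}^{1,1}$, where $\mathbb{R}^{1,1}$ has product $x\bullet y=-x^0y^0+x^1y^1$. Light cone coordinates of $(t,x)$ are $a=t+x$, $\bar a=t-x$; so $a_i=t_i+x_i^1$, $\bar a_i=t_i-x_i^1$. Causality conditions: $V_i^->0$ for all $i$; $p_1\cdot p_4<0$; $(x_i-x_j)\bullet(x_i-x_j)<0$ for the neighbouring edges $(ij)=(12),(23),(34),(14)$; and $t_1<t_3<t_4<t_2$. *)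

theory Defs
  imports "HOL-Analysis.Analysis"
begin

text \<open>
  A vector of \<open>\<real>\<^sup>2\<^sup>,\<^sup>2\<close> is \<open>X :: real ^ 4\<close>, whose components \<open>X $ 1, X $ 2, X $ 3, X $ 4\<close> are the
  contravariant components \<open>X\<^sup>-\<^sup>1, X\<^sup>0, X\<^sup>1, X\<^sup>2\<close>.
\<close>

definition inner22 :: "real ^ 4 \<Rightarrow> real ^ 4 \<Rightarrow> real" where
  "inner22 X Y = - X $ 1 * Y $ 1 - X $ 2 * Y $ 2 + X $ 3 * Y $ 3 + X $ 4 * Y $ 4"

text \<open>\<open>X\<^sup>+ = X\<^sup>1 + X\<^sup>-\<^sup>1\<close>, \<open>X\<^sup>- = X\<^sup>1 - X\<^sup>-\<^sup>1\<close>, \<open>X\<^sup>0 + X\<^sup>2\<close> and \<open>X\<^sup>0 - X\<^sup>2\<close>.\<close>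

definition cplus :: "real ^ 4 \<Rightarrow> real" where "cplus X = X $ 3 + X $ 1"
definition cminus :: "real ^ 4 \<Rightarrow> real" where "cminus X = X $ 3 - X $ 1"
definition clc :: "real ^ 4 \<Rightarrow> real" where "clc X = X $ 2 + X $ 4"
definition clcbar :: "real ^ 4 \<Rightarrow> real" where "clcbar X = X $ 2 - X $ 4"

definition AdS3 :: "real \<Rightarrow> (real ^ 4) set" where
  "AdS3 L = {X. inner22 X X = - L\<^sup>2}"

text \<open>Since the form is diagonal with entries \<open>\<plusminus>1\<close>, raising an index only changes signs.\<close>

definition raise_index :: "real ^ 4 \<Rightarrow> real ^ 4" where
  "raise_index w = vector [- w $ 1, - w $ 2, w $ 3, w $ 4]"

text \<open>The Levi-Civita symbol, normalised by \<open>\<epsilon>\<close> being \<open>1\<close> on the index sequence \<open>-1, 0, 1, 2\<close>.\<close>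

definition levi_civita :: "4 \<Rightarrow> 4 \<Rightarrow> 4 \<Rightarrow> 4 \<Rightarrow> real" where
  "levi_civita a b c d =
     (let \<sigma> = (\<lambda>i. (vector [a, b, c, d] :: 4 ^ 4) $ i)
      in if bij \<sigma> then of_int (sign \<sigma>) else 0)"

definition normal_lower :: "real ^ 4 \<Rightarrow> real ^ 4 \<Rightarrow> real ^ 4 \<Rightarrow> real ^ 4" where
  "normal_lower V p q =
     (\<chi> a. (\<Sum>b\<in>UNIV. \<Sum>c\<in>UNIV. \<Sum>d\<in>UNIV. levi_civita a b c d * V $ b * p $ c * q $ d)
            / inner22 p q)"

definition normal_vector :: "real ^ 4 \<Rightarrow> real ^ 4 \<Rightarrow> real ^ 4 \<Rightarrow> real ^ 4" where
  "normal_vector V p q = raise_index (normal_lower V p q)"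

text \<open>The vertices \<open>V 1, \<dots>, V 4\<close> and edges \<open>p 1, \<dots>, p 4\<close> of a segment; other indices are irrelevant.\<close>

definition string_segment :: "real \<Rightarrow> (nat \<Rightarrow> real ^ 4) \<Rightarrow> (nat \<Rightarrow> real ^ 4) \<Rightarrow> bool" where
  "string_segment L V p \<longleftrightarrow>
     V 1 \<in> AdS3 L \<and>
     inner22 (p 1) (p 1) = 0 \<and> inner22 (p 4) (p 4) = 0 \<and>
     inner22 (p 1) (V 1) = 0 \<and> inner22 (p 4) (V 1) = 0 \<and>
     V 2 = V 1 + p 1 \<and>
     V 4 = V 1 + p 4 \<and>
     V 3 = ((L\<^sup>2 + inner22 (p 1) (p 4) / 2) / (L\<^sup>2 - inner22 (p 1) (p 4) / 2)) *\<^sub>R V 1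
           + (L\<^sup>2 / (L\<^sup>2 - inner22 (p 1) (p 4) / 2)) *\<^sub>R (p 1 + p 4) \<and>
     p 2 = V 3 - V 2 \<and>
     p 3 = V 3 - V 4"

text \<open>Points \<open>(t, x)\<close> of \<open>\<real>\<^sup>1\<^sup>,\<^sup>1\<close> are pairs.\<close>

definition inner11 :: "real \<times> real \<Rightarrow> real \<times> real \<Rightarrow> real" where
  "inner11 x y = - fst x * fst y + snd x * snd y"

definition lc :: "real \<times> real \<Rightarrow> real" where "lc x = fst x + snd x"
definition lcbar :: "real \<times> real \<Rightarrow> real" where "lcbar x = fst x - snd x"

definition boundary_point :: "real \<Rightarrow> real ^ 4 \<Rightarrow> real \<times> real" where
  "boundary_point L p = (L / cminus p) *\<^sub>R (p $ 2, p $ 4)"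

definition causality_conditions :: "real \<Rightarrow> (nat \<Rightarrow> real ^ 4) \<Rightarrow> (nat \<Rightarrow> real ^ 4) \<Rightarrow> bool" where
  "causality_conditions L V p \<longleftrightarrow>
     (let x = (\<lambda>i. boundary_point L (p i)); t = (\<lambda>i. fst (x i)) in
       (\<forall>i\<in>{1..4}. cminus (V i) > 0) \<and>
       inner22 (p 1) (p 4) < 0 \<and>
       (\<forall>(i, j)\<in>{(1, 2), (2, 3), (3, 4), (1, 4)}. inner11 (x i - x j) (x i - x j) < 0) \<and>
       t 1 < t 3 \<and> t 3 < t 4 \<and> t 4 < t 2)"

definition timelike_line :: "(real \<times> real) set \<Rightarrow> bool" where
  "timelike_line S \<longleftrightarrow> (\<exists>c u. inner11 u u < 0 \<and> S = {c + s *\<^sub>R u | s. True})"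

text \<open>An inertial frame: origin \<open>c\<close> and an orthonormal basis with future-pointing \<open>e\<^sub>0\<close>.\<close>

definition inertial_frame :: "real \<times> real \<Rightarrow> real \<times> real \<Rightarrow> real \<times> real \<Rightarrow> bool" where
  "inertial_frame c e\<^sub>0 e\<^sub>1 \<longleftrightarrow>
     inner11 e\<^sub>0 e\<^sub>0 = -1 \<and> inner11 e\<^sub>1 e\<^sub>1 = 1 \<and> inner11 e\<^sub>0 e\<^sub>1 = 0 \<and> fst e\<^sub>0 > 0"

definition inertial_time_axis :: "(real \<times> real) set \<Rightarrow> bool" where
  "inertial_time_axis S \<longleftrightarrow>
     (\<exists>c e\<^sub>0 e\<^sub>1. inertial_frame c e\<^sub>0 e\<^sub>1 \<and> S = {c + s *\<^sub>R e\<^sub>0 | s. True})"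

text \<open>
  The world line of a future-directed motion parametrised by proper time (the speed of light is 1)
  over all of \<open>\<real>\<close>, with velocity \<open>u\<close> and acceleration \<open>w\<close> of constant Lorentzian length \<open>g\<close>.
\<close>

definition constant_acceleration_world_line :: "real \<Rightarrow> (real \<times> real) set \<Rightarrow> bool" where
  "constant_acceleration_world_line g S \<longleftrightarrow>
     (\<exists>\<gamma> u w :: real \<Rightarrow> real \<times> real.
        (\<forall>\<tau>. (\<gamma> has_vector_derivative u \<tau>) (at \<tau>)) \<and>
        (\<forall>\<tau>. (u has_vector_derivative w \<tau>) (at \<tau>)) \<and>
        (\<forall>\<tau>. inner11 (u \<tau>) (u \<tau>) = -1 \<and> fst (u \<tau>) > 0) \<and>
        (\<forall>\<tau>. sqrt (inner11 (w \<tau>) (w \<tau>)) = g) \<and>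
        S = range \<gamma>)"

end

theory Submission
  imports Defs
begin

text \<open>
  The edges \<open>p\<^sub>2, p\<^sub>3\<close> are combinations of \<open>V\<^sub>1, p\<^sub>1, p\<^sub>4\<close>, so all four \<open>p\<^sub>i\<close> are null and orthogonal to \<open>N\<close>.
  A null vector with \<open>p\<^sup>- \<noteq> 0\<close> satisfies \<open>p\<^sup>+ = p\<^sup>- a a' / L\<^sup>2\<close> in terms of the light cone coordinates
  \<open>a, a'\<close> of its boundary point, which turns \<open>N \<cdot> p = 0\<close> into the equation of the curve.
  For \<open>N\<^sup>- \<noteq> 0\<close> the points on the two branches of the hyperbola are spacelike separated from each other,
  hence the timelike separation of neighbours forces all four boundary points onto one branch.
\<close>

section \<open>The Levi-Civita symbol as a four by four determinant\<close>

lemma vector_4: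
  "(vector [x,y,z,w] :: 'a::zero^4) $ 1 = x"
  "(vector [x,y,z,w] :: 'a::zero^4) $ 2 = y"
  "(vector [x,y,z,w] :: 'a::zero^4) $ 3 = z"
  "(vector [x,y,z,w] :: 'a::zero^4) $ 4 = w"
  unfolding vector_def by simp_all

text \<open>The sum over permutations is expanded by peeling off one index at a time: each
  permutation of a set is a transposition moving the new index, composed with a permutation of the
  others.\<close>

lemma det_4:
  "det (A::'a::comm_ring_1^4^4) =
     A$1$1 * A$2$2 * A$3$3 * A$4$4 - A$1$1 * A$2$2 * A$3$4 * A$4$3
   - A$1$1 * A$2$3 * A$3$2 * A$4$4 + A$1$1 * A$2$3 * A$3$4 * A$4$2
   + A$1$1 * A$2$4 * A$3$2 * A$4$3 - A$1$1 * A$2$4 * A$3$3 * A$4$2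
   - A$1$2 * A$2$1 * A$3$3 * A$4$4 + A$1$2 * A$2$1 * A$3$4 * A$4$3
   + A$1$2 * A$2$3 * A$3$1 * A$4$4 - A$1$2 * A$2$3 * A$3$4 * A$4$1
   - A$1$2 * A$2$4 * A$3$1 * A$4$3 + A$1$2 * A$2$4 * A$3$3 * A$4$1
   + A$1$3 * A$2$1 * A$3$2 * A$4$4 - A$1$3 * A$2$1 * A$3$4 * A$4$2
   - A$1$3 * A$2$2 * A$3$1 * A$4$4 + A$1$3 * A$2$2 * A$3$4 * A$4$1
   + A$1$3 * A$2$4 * A$3$1 * A$4$2 - A$1$3 * A$2$4 * A$3$2 * A$4$1
   - A$1$4 * A$2$1 * A$3$2 * A$4$3 + A$1$4 * A$2$1 * A$3$3 * A$4$2
   + A$1$4 * A$2$2 * A$3$1 * A$4$3 - A$1$4 * A$2$2 * A$3$3 * A$4$1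
   - A$1$4 * A$2$3 * A$3$1 * A$4$2 + A$1$4 * A$2$3 * A$3$2 * A$4$1"
proof -
  have f1: "finite {2::4, 3, 4}" "1 \<notin> {2::4, 3, 4}" by auto
  have f2: "finite {3::4, 4}" "2 \<notin> {3::4, 4}" by auto
  have f3: "finite {4::4}" "3 \<notin> {4::4}" by auto
  show ?thesis
    unfolding det_def UNIV_4
    unfolding sum_over_permutations_insert[OF f1]
      sum_over_permutations_insert[OF f2] sum_over_permutations_insert[OF f3]
    unfolding permutes_sing
    by (simp add: sign_swap_id permutation_swap_id permutation_compose sign_compose sign_id swap_id_eq)
qed

text \<open>The rows are standard basis vectors. For a bijective index sequence they are the
  identity matrix with permuted rows, otherwise two rows coincide. This makes concrete values of the
  symbol computable by \<open>det_4\<close>.\<close>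

lemma levi_civita_eq_det:
  "levi_civita a b c d = det (\<chi> i. axis (vector [a, b, c, d] $ i) 1 :: real^4^4)"
proof -
  define f where "f = (\<lambda>i. (vector [a, b, c, d] :: 4^4) $ i)"
  have "(if bij f then of_int (sign f) else 0) = det (\<chi> i. axis (f i) 1 :: real^4^4)"
  proof (cases "bij f")
    case True
    then have "f permutes UNIV" by (intro bij_imp_permutes) auto
    then have "det (\<chi> i. mat 1 $ f i :: real^4^4) = of_int (sign f) * det (mat 1 :: real^4^4)"
      by (rule det_permute_rows)
    moreover have "(\<chi> i. mat 1 $ f i :: real^4^4) = (\<chi> i. axis (f i) 1)"
      by (auto simp: mat_def axis_def vec_eq_iff)
    ultimately show ?thesis using True by simp
  next
    case False
    then have "\<not> inj f" by (simp add: bij_def finite_UNIV_inj_surj)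
    then obtain i j where "i \<noteq> j" "f i = f j" by (auto simp: inj_def)
    then have "det (\<chi> i. axis (f i) 1 :: real^4^4) = 0"
      by (intro det_identical_rows[of i j]) (auto simp: row_def)
    with False show ?thesis by simp
  qed
  then show ?thesis unfolding levi_civita_def Let_def f_def .
qed

section \<open>The bilinear form and the normal vector\<close>

lemma inner22_simps:
  "inner22 (X + Y) Z = inner22 X Z + inner22 Y Z"
  "inner22 X (Y + Z) = inner22 X Y + inner22 X Z"
  "inner22 (r *\<^sub>R X) Y = r * inner22 X Y"
  "inner22 X (r *\<^sub>R Y) = r * inner22 X Y"
  by (simp_all add: inner22_def algebra_simps)

lemma inner22_commute: "inner22 X Y = inner22 Y X"
  by (simp add: inner22_def mult.commute)

text \<open>This form of the product yields the norm relation for \<open>n\<close>, the nullity of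
  an edge and its orthogonality to \<open>n\<close>, all in light cone components.\<close>

lemma inner22_light_cone:
  "2 * inner22 X Y = cplus X * cminus Y + cminus X * cplus Y - clc X * clcbar Y - clcbar X * clc Y"
  by (simp add: inner22_def cplus_def cminus_def clc_def clcbar_def algebra_simps)

text \<open>The numerators are the cofactors along the first row of a determinant whose other rows
  are \<open>V\<close>, \<open>p\<close>, \<open>q\<close>.\<close>

lemma normal_lower_components:
  "normal_lower V p q $ 1 =
     (V$2 * (p$3 * q$4 - p$4 * q$3) - V$3 * (p$2 * q$4 - p$4 * q$2) + V$4 * (p$2 * q$3 - p$3 * q$2)) / inner22 p q"
  "normal_lower V p q $ 2 =
     - (V$1 * (p$3 * q$4 - p$4 * q$3) - V$3 * (p$1 * q$4 - p$4 * q$1) + V$4 * (p$1 * q$3 - p$3 * q$1)) / inner22 p q"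
  "normal_lower V p q $ 3 =
     (V$1 * (p$2 * q$4 - p$4 * q$2) - V$2 * (p$1 * q$4 - p$4 * q$1) + V$4 * (p$1 * q$2 - p$2 * q$1)) / inner22 p q"
  "normal_lower V p q $ 4 =
     - (V$1 * (p$2 * q$3 - p$3 * q$2) - V$2 * (p$1 * q$3 - p$3 * q$1) + V$3 * (p$1 * q$2 - p$2 * q$1)) / inner22 p q"
  by (simp_all add: normal_lower_def sum_4 levi_civita_eq_det det_4 vector_4 axis_def right_diff_distrib)

lemma inner22_normal_vector: "inner22 (normal_vector V p q) X = (\<Sum>a\<in>UNIV. normal_lower V p q $ a * X $ a)"
  by (simp add: inner22_def normal_vector_def raise_index_def vector_4 sum_4)

text \<open>Pairing with \<open>X\<close> gives, up to the factor \<open>1 / inner22 p q\<close>,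
  the determinant with rows \<open>X\<close>, \<open>V\<close>, \<open>p\<close>, \<open>q\<close>;
  it vanishes when \<open>X\<close> repeats another row.\<close>

lemma normal_vector_orthogonal:
  "inner22 (normal_vector V p q) V = 0"
  "inner22 (normal_vector V p q) p = 0"
  "inner22 (normal_vector V p q) q = 0"
  unfolding inner22_normal_vector sum_4 normal_lower_components times_divide_eq_left
    add_divide_distrib[symmetric] divide_eq_0_iff
  by (intro disjI1; algebra)+

text \<open>Under the orthogonality and nullity assumptions only the term with the square of
  \<open>inner22 p q\<close> survives, and the denominator of the normal vector cancels it.\<close>

lemma normal_vector_norm:
  assumes "inner22 p p = 0" "inner22 q q = 0" "inner22 p V = 0" "inner22 q V = 0" "inner22 p q \<noteq> 0"
  shows "inner22 (normal_vector V p q) (normal_vector V p q) = - inner22 V V"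
proof -
  define k where "k = inner22 p q"
  define m where "m = k *\<^sub>R normal_lower V p q"
  have nm: "normal_vector V p q = (1 / k) *\<^sub>R raise_index m"
    using assms(5) by (simp add: normal_vector_def raise_index_def m_def k_def vec_eq_iff forall_4 vector_4)
  have m: "m$1 = V$2 * (p$3 * q$4 - p$4 * q$3) - V$3 * (p$2 * q$4 - p$4 * q$2) + V$4 * (p$2 * q$3 - p$3 * q$2)"
    "m$2 = - (V$1 * (p$3 * q$4 - p$4 * q$3) - V$3 * (p$1 * q$4 - p$4 * q$1) + V$4 * (p$1 * q$3 - p$3 * q$1))"
    "m$3 = V$1 * (p$2 * q$4 - p$4 * q$2) - V$2 * (p$1 * q$4 - p$4 * q$1) + V$4 * (p$1 * q$2 - p$2 * q$1)"
    "m$4 = - (V$1 * (p$2 * q$3 - p$3 * q$2) - V$2 * (p$1 * q$3 - p$3 * q$1) + V$3 * (p$1 * q$2 - p$2 * q$1))"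
    using assms(5) by (simp_all add: m_def k_def normal_lower_components)
  \<comment> \<open>The square of the triple product is the Gram determinant of its factors.\<close>
  have "inner22 (raise_index m) (raise_index m) =
      inner22 V V * (inner22 p p * inner22 q q - inner22 p q ^ 2)
      - inner22 p V * (inner22 p V * inner22 q q - inner22 p q * inner22 q V)
      + inner22 q V * (inner22 p V * inner22 p q - inner22 p p * inner22 q V)"
    unfolding inner22_def raise_index_def vector_4 m by algebra
  then have "inner22 (raise_index m) (raise_index m) = - (k ^ 2) * inner22 V V"
    using assms by (simp add: k_def)
  then show ?thesis
    using assms(5) by (simp add: nm inner22_simps k_def power2_eq_square)
qed

section \<open>Null edges orthogonal to the normal vector\<close>

lemma boundary_point_equation:
  assumes "inner22 p p = 0" "inner22 n p = 0" "cminus p \<noteq> 0"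
  shows "cminus n * lcbar (boundary_point L p) * lc (boundary_point L p)
    - clc n * lcbar (boundary_point L p) * L - clcbar n * lc (boundary_point L p) * L
    + cplus n * L\<^sup>2 = 0"
proof -
  define m where "m = cminus p"
  have a: "lc (boundary_point L p) = L * clc p / m" "lcbar (boundary_point L p) = L * clcbar p / m"
    by (simp_all add: lc_def lcbar_def boundary_point_def clc_def clcbar_def m_def algebra_simps add_divide_distrib diff_divide_distrib)
  have null: "clcbar p * clc p = m * cplus p"
    using assms(1) inner22_light_cone[of p p] by (simp add: m_def algebra_simps)
  have orth: "cminus n * cplus p - clc n * clcbar p - clcbar n * clc p + cplus n * m = 0"
    using assms(2) inner22_light_cone[of n p] by (simp add: m_def algebra_simps)
  have "m \<noteq> 0" using assms(3) by (simp add: m_def)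
  have "cminus n * (L * clcbar p / m) * (L * clc p / m) = L\<^sup>2 / m\<^sup>2 * cminus n * (clcbar p * clc p)"
    by (simp add: power2_eq_square)
  also have "\<dots> = L\<^sup>2 / m * (cminus n * cplus p)"
    using \<open>m \<noteq> 0\<close> by (simp add: null power2_eq_square)
  \<comment> \<open>Nullity has turned the quadratic term into one linear in \<open>p\<close>, so
    all four terms share the factor \<open>L\<^sup>2 / m\<close>; the other factor is twice the
    product of \<open>n\<close> and \<open>p\<close>.\<close>
  finally have "cminus n * (L * clcbar p / m) * (L * clc p / m)
    - clc n * (L * clcbar p / m) * L - clcbar n * (L * clc p / m) * L + cplus n * L\<^sup>2
    = L\<^sup>2 / m * (cminus n * cplus p - clc n * clcbar p - clcbar n * clc p + cplus n * m)"
    using \<open>m \<noteq> 0\<close> by (simp add: field_simps power2_eq_square)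
  then show ?thesis by (simp add: a orth)
qed

lemma string_segment_edges:
  assumes seg: "string_segment L V p" and "inner22 (p 1) (p 4) < 0" and "j \<in> {1..4}"
  shows "inner22 (p j) (p j) = 0" and "inner22 (normal_vector (V 1) (p 1) (p 4)) (p j) = 0"
proof -
  define k where "k = inner22 (p 1) (p 4)"
  define D where "D = L\<^sup>2 - k / 2"
  define n where "n = normal_vector (V 1) (p 1) (p 4)"
  have "k < 0" using assms(2) by (simp add: k_def)
  then have "D > 0" using zero_le_power2[of L] unfolding D_def by linarith
  have g: "inner22 (V 1) (V 1) = - L\<^sup>2" "inner22 (p 1) (p 1) = 0" "inner22 (p 4) (p 4) = 0"
    "inner22 (p 1) (V 1) = 0" "inner22 (p 4) (V 1) = 0" "inner22 (V 1) (p 1) = 0" "inner22 (V 1) (p 4) = 0"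
    "inner22 (p 1) (p 4) = k" "inner22 (p 4) (p 1) = k"
    using seg by (auto simp: string_segment_def AdS3_def k_def inner22_commute)
  have o: "inner22 n (V 1) = 0" "inner22 n (p 1) = 0" "inner22 n (p 4) = 0"
    by (simp_all add: n_def normal_vector_orthogonal)
  have V3: "V 3 = ((L\<^sup>2 + k / 2) / D) *\<^sub>R V 1 + (L\<^sup>2 / D) *\<^sub>R (p 1 + p 4)"
    using seg by (simp add: string_segment_def k_def D_def)
  \<comment> \<open>Both numerators are written as \<open>D\<close> plus a multiple of
    \<open>k\<close>, so that subtracting 1 leaves the coefficients of \<open>V 1\<close> and of the
    subtracted edge.\<close>
  have c: "(L\<^sup>2 + k / 2) / D = 1 + k / D" "L\<^sup>2 / D = 1 + k / (2 * D)"
    using \<open>D > 0\<close> by (simp_all add: D_def field_simps)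
  have p2: "p 2 = (k / D) *\<^sub>R V 1 + (k / (2 * D)) *\<^sub>R p 1 + (L\<^sup>2 / D) *\<^sub>R p 4"
  proof -
    have "p 2 = V 3 - V 1 - p 1" using seg by (simp add: string_segment_def)
    also have "\<dots> = ((L\<^sup>2 + k / 2) / D - 1) *\<^sub>R V 1 + (L\<^sup>2 / D - 1) *\<^sub>R p 1 + (L\<^sup>2 / D) *\<^sub>R p 4"
      by (simp add: V3 algebra_simps)
    finally show ?thesis using c by simp
  qed
  have p3: "p 3 = (k / D) *\<^sub>R V 1 + (L\<^sup>2 / D) *\<^sub>R p 1 + (k / (2 * D)) *\<^sub>R p 4"
  proof -
    have "p 3 = V 3 - V 1 - p 4" using seg by (simp add: string_segment_def)
    also have "\<dots> = ((L\<^sup>2 + k / 2) / D - 1) *\<^sub>R V 1 + (L\<^sup>2 / D) *\<^sub>R p 1 + (L\<^sup>2 / D - 1) *\<^sub>R p 4"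
      by (simp add: V3 algebra_simps)
    finally show ?thesis using c by simp
  qed
  \<comment> \<open>The square of the \<open>V 1\<close> part contributes
    \<open>- L\<^sup>2 * k\<^sup>2 / D\<^sup>2\<close>, which the mixed term of \<open>p 1\<close>
    and \<open>p 4\<close> cancels.\<close>
  have "inner22 (p 2) (p 2) = 0" "inner22 (p 3) (p 3) = 0"
    unfolding p2 p3 inner22_simps g by (simp_all add: algebra_simps)
  moreover have "inner22 n (p 2) = 0" "inner22 n (p 3) = 0"
    unfolding p2 p3 inner22_simps o by simp_all
  moreover have "j = 1 \<or> j = 2 \<or> j = 3 \<or> j = 4" using assms(3) by auto
  ultimately show "inner22 (p j) (p j) = 0" "inner22 (normal_vector (V 1) (p 1) (p 4)) (p j) = 0"
    using g o by (auto simp: n_def)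
qed

section \<open>Timelike lines as time axes\<close>

lemma inertial_time_axis_imp_timelike_line: "inertial_time_axis S \<Longrightarrow> timelike_line S"
  unfolding inertial_time_axis_def timelike_line_def inertial_frame_def
  by (metis neg_less_0_iff_less zero_less_one)

lemma inertial_time_axis_line:
  fixes A B C :: real
  assumes "A\<^sup>2 < B\<^sup>2"
  shows "inertial_time_axis {y. A * fst y + B * snd y = C}"
proof -
  define r where "r = sqrt (B\<^sup>2 - A\<^sup>2)"
  have r: "r > 0" "r\<^sup>2 = B\<^sup>2 - A\<^sup>2" using assms by (simp_all add: r_def)
  have B: "B \<noteq> 0" using assms by (auto simp: not_less)
  \<comment> \<open>The direction of the line is \<open>(B, - A)\<close>; the factor
    \<open>sgn B\<close> makes it future-pointing and \<open>r\<close> normalises it. Swapping its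
    components gives the orthogonal vector \<open>e1\<close>.\<close>
  define e0 where "e0 = (\<bar>B\<bar> / r, - A * sgn B / r)"
  define e1 where "e1 = (- A * sgn B / r, \<bar>B\<bar> / r)"
  have sg: "sgn B * sgn B = 1" using B by (simp add: sgn_if)
  have "(\<bar>B\<bar> / r)\<^sup>2 - (- A * sgn B / r)\<^sup>2 = (B\<^sup>2 - A\<^sup>2) / r\<^sup>2"
    using sg by (simp add: power2_eq_square diff_divide_distrib)
  also have "\<dots> = 1" using r by (metis divide_self less_irrefl zero_less_power)
  finally have "inertial_frame (0, C / B) e0 e1"
    using r B by (simp add: inertial_frame_def inner11_def e0_def e1_def power2_eq_square)
  moreover have "{y. A * fst y + B * snd y = C} = {(0, C / B) + s *\<^sub>R e0 | s. True}"
  proof (intro set_eqI iffI)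
    fix y assume "y \<in> {y. A * fst y + B * snd y = C}"
    then have y: "snd y = C / B - A * fst y / B" using B by (simp add: field_simps)
    \<comment> \<open>The parameter \<open>fst y * r / \<bar>B\<bar>\<close> comes from solving the
      time component for \<open>s\<close>.\<close>
    have "snd y = C / B - (fst y * r / \<bar>B\<bar>) * (A * sgn B / r)"
      using r(1) B by (cases "B > 0") (simp_all add: y)
    then have "y = (0, C / B) + (fst y * r / \<bar>B\<bar>) *\<^sub>R e0"
      using r B by (intro prod_eqI) (simp_all add: e0_def)
    then show "y \<in> {(0, C / B) + s *\<^sub>R e0 | s. True}" by blast
  next
    fix y assume "y \<in> {(0, C / B) + s *\<^sub>R e0 | s. True}"
    then obtain s where "y = (0, C / B) + s *\<^sub>R e0" by blast
    moreover have "B * sgn B = \<bar>B\<bar>" by (simp add: sgn_if)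
    ultimately show "y \<in> {y. A * fst y + B * snd y = C}"
      using r B by (simp add: e0_def) (simp add: field_simps)
  qed
  ultimately show ?thesis unfolding inertial_time_axis_def by blast
qed

section \<open>Branches of a hyperbola and constant acceleration\<close>

text \<open>By the intermediate value theorem no connected subset of \<open>S\<close> meets both
  signs of \<open>f\<close>, so the two connected sign regions are maximal.\<close>

lemma components_sign_partition:
  fixes f :: "'a::topological_space \<Rightarrow> real"
  assumes cont: "continuous_on S f" and nz: "\<And>x. x \<in> S \<Longrightarrow> f x \<noteq> 0"
    and A: "A = {x \<in> S. f x > 0}" "connected A" "A \<noteq> {}"
    and B: "B = {x \<in> S. f x < 0}" "connected B" "B \<noteq> {}"
  shows "components S = {A, B}"
proof -
  have one_sign: "C \<subseteq> A \<or> C \<subseteq> B" if C: "connected C" "C \<subseteq> S" for C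
  proof (rule ccontr)
    assume "\<not> (C \<subseteq> A \<or> C \<subseteq> B)"
    then obtain x y where "x \<in> C" "x \<notin> A" "y \<in> C" "y \<notin> B" by blast
    then have xy: "x \<in> C" "y \<in> C" "f x < 0" "f y > 0"
      using C(2) nz[of x] nz[of y] by (auto simp: A(1) B(1))
    have "connected (f ` C)"
      using C cont by (meson connected_continuous_image continuous_on_subset)
    then have "0 \<in> f ` C"
      using xy by (meson connectedD_interval image_eqI less_imp_le)
    then show False using nz C(2) by auto
  qed
  have "A \<inter> B = {}" by (auto simp: A(1) B(1))
  have comp: "C \<in> components S" if C: "C \<in> {A, B}" for C
  proof -
    have sub: "C \<subseteq> S" "connected C" "C \<noteq> {}" using C A B by auto
    have "D = C" if D: "D \<noteq> {}" "C \<subseteq> D" "D \<subseteq> S" "connected D" for D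
      using one_sign[OF D(4,3)] D(2) C sub(3) \<open>A \<inter> B = {}\<close> by blast
    then show ?thesis using sub by (auto simp: in_components_maximal)
  qed
  have "C \<in> {A, B}" if C: "C \<in> components S" for C
  proof -
    have "C \<subseteq> A \<or> C \<subseteq> B" "C \<noteq> {}"
      using C one_sign in_components_connected in_components_subset in_components_nonempty by metis+
    \<comment> \<open>Components that meet are equal, and \<open>A\<close> and \<open>B\<close> are
      already known to be components.\<close>
    then have "\<exists>D\<in>{A, B}. C \<inter> D \<noteq> {}" by blast
    then show ?thesis using C comp components_eq by metis
  qed
  with comp show ?thesis by blast
qed

text \<open>The sign \<open>s\<close>, equal to 1 or -1, selects the right or left branch; the
  nonnegative root encodes the side of \<open>x0\<close>.\<close>

definition hyperbola_branch :: "real \<Rightarrow> real \<Rightarrow> real \<Rightarrow> real \<Rightarrow> (real \<times> real) set" where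
  "hyperbola_branch r t0 x0 s = {y. s * (snd y - x0) = sqrt (r\<^sup>2 + (fst y - t0)\<^sup>2)}"

text \<open>Hyperbolic motion with proper time \<tau> and rapidity \<open>\<tau> / r\<close>, up to
  the sign \<open>s\<close>.\<close>

definition hyperbola_param :: "real \<Rightarrow> real \<Rightarrow> real \<Rightarrow> real \<Rightarrow> real \<Rightarrow> real \<times> real" where
  "hyperbola_param r t0 x0 s \<tau> = (t0 + r * sinh (\<tau> / r), x0 + s * r * cosh (\<tau> / r))"

lemma range_hyperbola_param:
  assumes "r > 0" "s * s = 1"
  shows "range (hyperbola_param r t0 x0 s) = hyperbola_branch r t0 x0 s"
proof (intro set_eqI iffI)
  fix y assume "y \<in> range (hyperbola_param r t0 x0 s)"
  then obtain \<tau> where y: "y = hyperbola_param r t0 x0 s \<tau>" by blast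
  have "r\<^sup>2 + (r * sinh (\<tau> / r))\<^sup>2 = (r * cosh (\<tau> / r))\<^sup>2"
    by (simp add: power_mult_distrib cosh_square_eq algebra_simps)
  then show "y \<in> hyperbola_branch r t0 x0 s"
    using assms by (simp add: hyperbola_branch_def y hyperbola_param_def real_sqrt_abs abs_mult mult.assoc[symmetric])
next
  fix y assume y: "y \<in> hyperbola_branch r t0 x0 s"
  \<comment> \<open>This inverts the time component of the parametrisation; the branch equation then
    forces the space component.\<close>
  define \<tau> where "\<tau> = r * arsinh ((fst y - t0) / r)"
  have "r * cosh (\<tau> / r) = sqrt (r\<^sup>2 * (((fst y - t0) / r)\<^sup>2 + 1))"
    using assms by (simp add: \<tau>_def cosh_arsinh_real real_sqrt_mult)
  also have "r\<^sup>2 * (((fst y - t0) / r)\<^sup>2 + 1) = r\<^sup>2 + (fst y - t0)\<^sup>2"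
    using assms by (simp add: power_divide algebra_simps)
  finally have "r * cosh (\<tau> / r) = s * (snd y - x0)"
    using y by (simp add: hyperbola_branch_def)
  then have "s * r * cosh (\<tau> / r) = (s * s) * (snd y - x0)" by simp
  then have "y = hyperbola_param r t0 x0 s \<tau>"
    using assms by (intro prod_eqI) (simp_all add: hyperbola_param_def \<tau>_def)
  then show "y \<in> range (hyperbola_param r t0 x0 s)" by blast
qed

text \<open>The identity for \<open>cosh\<close> and \<open>sinh\<close> normalises the velocity and
  gives the acceleration the length \<open>1 / r\<close>.\<close>

lemma hyperbola_branch_world_line:
  assumes "r > 0" "s * s = 1"
  shows "constant_acceleration_world_line (1 / r) (hyperbola_branch r t0 x0 s)"
proof -
  define u where "u = (\<lambda>\<tau>. (cosh (\<tau> / r), s * sinh (\<tau> / r)))"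
  define w where "w = (\<lambda>\<tau>. (sinh (\<tau> / r) / r, s * cosh (\<tau> / r) / r))"
  have "(hyperbola_param r t0 x0 s has_vector_derivative u \<tau>) (at \<tau>)" for \<tau>
    unfolding hyperbola_param_def u_def
    by (intro has_vector_derivative_Pair)
      (use assms(1) in \<open>auto intro!: derivative_eq_intros simp: has_real_derivative_iff_has_vector_derivative[symmetric]\<close>)
  moreover have "(u has_vector_derivative w \<tau>) (at \<tau>)" for \<tau>
    unfolding u_def w_def
    by (intro has_vector_derivative_Pair)
      (use assms(1) in \<open>auto intro!: derivative_eq_intros simp: has_real_derivative_iff_has_vector_derivative[symmetric]\<close>)
  moreover have "inner11 (u \<tau>) (u \<tau>) = - 1" "fst (u \<tau>) > 0" for \<tau>
  proof -
    have "inner11 (u \<tau>) (u \<tau>) = - (cosh (\<tau> / r))\<^sup>2 + (s * s) * (sinh (\<tau> / r))\<^sup>2"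
      by (simp add: inner11_def u_def power2_eq_square algebra_simps)
    then show "inner11 (u \<tau>) (u \<tau>) = - 1" using assms(2) by (simp add: cosh_square_eq)
    show "fst (u \<tau>) > 0" by (simp add: u_def)
  qed
  moreover have "sqrt (inner11 (w \<tau>) (w \<tau>)) = 1 / r" for \<tau>
  proof -
    have "inner11 (w \<tau>) (w \<tau>) = ((s * s) * (cosh (\<tau> / r))\<^sup>2 - (sinh (\<tau> / r))\<^sup>2) / r\<^sup>2"
      by (simp add: inner11_def w_def power2_eq_square algebra_simps diff_divide_distrib)
    then have "inner11 (w \<tau>) (w \<tau>) = (1 / r)\<^sup>2"
      using assms(2) by (simp add: cosh_square_eq power_divide)
    then show ?thesis using assms(1) by simp
  qed
  ultimately show ?thesis
    unfolding constant_acceleration_world_line_def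
    using range_hyperbola_param[OF assms, of t0 x0] by metis
qed

lemma connected_hyperbola_branch:
  assumes "r > 0" "s * s = 1"
  shows "connected (hyperbola_branch r t0 x0 s)"
proof -
  have "continuous_on UNIV (hyperbola_param r t0 x0 s)"
    unfolding hyperbola_param_def using assms(1) by (intro continuous_intros) auto
  then have "connected (range (hyperbola_param r t0 x0 s))"
    by (rule connected_continuous_image) (rule connected_UNIV)
  then show ?thesis by (simp add: range_hyperbola_param[OF assms])
qed

text \<open>Since \<open>r > 0\<close>, the function \<open>snd y - x0\<close> has no zero on the
  hyperbola, and its sign tells the branches apart.\<close>

lemma components_hyperbola:
  assumes "r > 0"
  shows "components {y. (snd y - x0)\<^sup>2 = r\<^sup>2 + (fst y - t0)\<^sup>2} =
    {hyperbola_branch r t0 x0 1, hyperbola_branch r t0 x0 (- 1)}"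
    (is "components ?H = _")
proof (rule components_sign_partition[where f = "\<lambda>y. snd y - x0"])
  have pos: "r\<^sup>2 + a\<^sup>2 > 0" for a :: real using assms by (simp add: add_pos_nonneg)
  have iff: "y \<in> hyperbola_branch r t0 x0 s \<longleftrightarrow> y \<in> ?H \<and> s * (snd y - x0) > 0" if s: "s * s = 1" for s y
  proof -
    have "(s * (snd y - x0))\<^sup>2 = (snd y - x0)\<^sup>2"
      using s by (simp add: power_mult_distrib power2_eq_square)
    then show ?thesis
      using pos[of "fst y - t0"] real_sqrt_gt_0_iff[of "r\<^sup>2 + (fst y - t0)\<^sup>2"]
      unfolding hyperbola_branch_def mem_Collect_eq
      by (metis less_imp_le real_sqrt_pow2 real_sqrt_unique)
  qed
  show "continuous_on ?H (\<lambda>y. snd y - x0)" by (intro continuous_intros)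
  show "snd y - x0 \<noteq> 0" if "y \<in> ?H" for y
    using that pos[of "fst y - t0"] by auto
  show "hyperbola_branch r t0 x0 1 = {y \<in> ?H. snd y - x0 > 0}" "hyperbola_branch r t0 x0 (- 1) = {y \<in> ?H. snd y - x0 < 0}"
    using iff[of 1] iff[of "- 1"] by auto
  show "connected (hyperbola_branch r t0 x0 1)" "connected (hyperbola_branch r t0 x0 (- 1))"
    using assms by (simp_all add: connected_hyperbola_branch)
  show "hyperbola_branch r t0 x0 1 \<noteq> {}" "hyperbola_branch r t0 x0 (- 1) \<noteq> {}"
    using assms by (simp_all flip: range_hyperbola_param)
qed

text \<open>The branches lie in opposite wedges with apex \<open>(t0, x0)\<close>, and points of
  opposite wedges are never timelike separated.\<close>

lemma timelike_separated_imp_same_branch: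
  assumes "y \<in> hyperbola_branch r t0 x0 s" "z \<in> hyperbola_branch r t0 x0 s'" "s * s = 1" "s' * s' = 1"
    "inner11 (y - z) (y - z) < 0"
  shows "s = s'"
proof (rule ccontr)
  assume "s \<noteq> s'"
  then have s': "s' = - s" using square_eq_iff[of s' s] assms(3,4) by simp
  have "\<bar>fst y - t0\<bar> \<le> s * (snd y - x0)" "\<bar>fst z - t0\<bar> \<le> - s * (snd z - x0)"
    using assms(1,2) unfolding hyperbola_branch_def s' mem_Collect_eq by (simp_all add: real_le_rsqrt)
  \<comment> \<open>Adding the two wedge bounds eliminates the apex.\<close>
  then have "\<bar>fst y - fst z\<bar> \<le> s * (snd y - snd z)"
    by (simp add: algebra_simps)
  then have "\<bar>fst y - fst z\<bar>\<^sup>2 \<le> (s * (snd y - snd z))\<^sup>2"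
    by (intro power_mono) auto
  then have "(fst y - fst z)\<^sup>2 \<le> (s * s) * (snd y - snd z)\<^sup>2"
    by (simp add: power2_eq_square algebra_simps)
  then show False
    using assms(3,5) by (simp add: inner11_def power2_eq_square algebra_simps)
qed

text \<open>The product of the shifted light cone coordinates is a difference of squares centred at
  the point with light cone coordinates \<open>a0\<close> and \<open>abar0\<close>.\<close>

lemma hyperbola_light_cone:
  "{y. - (lcbar y - abar0) * (lc y - a0) = r\<^sup>2}
    = {y. (snd y - (a0 - abar0) / 2)\<^sup>2 = r\<^sup>2 + (fst y - (a0 + abar0) / 2)\<^sup>2}"
  by (auto simp: lc_def lcbar_def power2_eq_square field_simps)

section \<open>The curve through the four boundary points\<close>

theorem mainTheorem6:
  fixes L :: real and V p :: "nat \<Rightarrow> real ^ 4"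
  assumes "L > 0"
    and "string_segment L V p"
    and "\<forall>i\<in>{1..4}. cminus (p i) \<noteq> 0"
    and "causality_conditions L V p"
  shows
    "let x = (\<lambda>j. boundary_point L (p j));
         n = normal_vector (V 1) (p 1) (p 4);
         Np = cplus n; Nm = cminus n; N = clc n; Nbar = clcbar n
     in
       Np * Nm - N * Nbar = L\<^sup>2 \<and>
       (\<forall>j\<in>{1..4}.
          Nm * lcbar (x j) * lc (x j) - N * lcbar (x j) * L - Nbar * lc (x j) * L + Np * L\<^sup>2 = 0) \<and>
       (Nm = 0 \<longrightarrow>
          (let l = {y. N * lcbar y + Nbar * lc y = Np * L}
           in timelike_line l \<and> inertial_time_axis l \<and> (\<forall>j\<in>{1..4}. x j \<in> l))) \<and>
       (Nm \<noteq> 0 \<longrightarrow>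
          (let a0 = L * (N / Nm); abar0 = L * (Nbar / Nm); \<rho> = L\<^sup>2 / \<bar>Nm\<bar>; g = \<bar>Nm\<bar> / L\<^sup>2;
               h = {y. - (lcbar y - abar0) * (lc y - a0) = \<rho>\<^sup>2}
           in (\<forall>j\<in>{1..4}. x j \<in> h) \<and>
              (\<forall>B\<in>components h. constant_acceleration_world_line g B) \<and>
              (\<exists>B\<in>components h. \<forall>j\<in>{1..4}. x j \<in> B)))"
proof -
  define x where "x = (\<lambda>j. boundary_point L (p j))"
  define n where "n = normal_vector (V 1) (p 1) (p 4)"
  define Np where "Np = cplus n"
  define Nm where "Nm = cminus n"
  define N where "N = clc n"
  define Nbar where "Nbar = clcbar n"
  have neg: "inner22 (p 1) (p 4) < 0"
    and timelike: "inner11 (x 1 - x 2) (x 1 - x 2) < 0" "inner11 (x 2 - x 3) (x 2 - x 3) < 0"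
      "inner11 (x 3 - x 4) (x 3 - x 4) < 0"
    using assms(4) by (auto simp: causality_conditions_def Let_def x_def)
  have "inner22 n n = L\<^sup>2"
    using assms(2) neg normal_vector_norm[of "p 1" "p 4" "V 1"]
    by (simp add: string_segment_def AdS3_def n_def)
  then have norm: "Np * Nm - N * Nbar = L\<^sup>2"
    using inner22_light_cone[of n n] by (simp add: Np_def Nm_def N_def Nbar_def algebra_simps)
  have eq: "Nm * lcbar (x j) * lc (x j) - N * lcbar (x j) * L - Nbar * lc (x j) * L + Np * L\<^sup>2 = 0"
    if "j \<in> {1..4}" for j
    using boundary_point_equation string_segment_edges[OF assms(2) neg that] assms(3) that
    by (simp add: x_def Np_def Nm_def N_def Nbar_def n_def)
  have inertial: "timelike_line l \<and> inertial_time_axis l \<and> (\<forall>j\<in>{1..4}. x j \<in> l)"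
    if "Nm = 0" and l: "l = {y. N * lcbar y + Nbar * lc y = Np * L}" for l
  proof -
    \<comment> \<open>The left side is \<open>4 * N * Nbar\<close>, and the norm relation gives
      \<open>N * Nbar = - L\<^sup>2\<close> here; its negativity is what makes the line
      timelike.\<close>
    have "(N + Nbar)\<^sup>2 - (Nbar - N)\<^sup>2 = - 4 * L\<^sup>2"
      using norm \<open>Nm = 0\<close> by (simp add: power2_eq_square algebra_simps)
    moreover have "L\<^sup>2 > 0" using assms(1) by simp
    ultimately have "(N + Nbar)\<^sup>2 < (Nbar - N)\<^sup>2" by linarith
    then have "inertial_time_axis {y. (N + Nbar) * fst y + (Nbar - N) * snd y = Np * L}"
      by (rule inertial_time_axis_line)
    also have "{y. (N + Nbar) * fst y + (Nbar - N) * snd y = Np * L} = l"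
      by (simp add: l lc_def lcbar_def algebra_simps)
    finally have "inertial_time_axis l" .
    moreover have "x j \<in> l" if "j \<in> {1..4}" for j
    proof -
      have "L * (N * lcbar (x j) + Nbar * lc (x j)) = L * (Np * L)"
        using eq[OF that] \<open>Nm = 0\<close> by (simp add: power2_eq_square algebra_simps)
      then show ?thesis using assms(1) by (simp add: l)
    qed
    ultimately show ?thesis by (simp add: inertial_time_axis_imp_timelike_line)
  qed
  \<comment> \<open>A world line is connected while the hyperbola has two branches, so acceleration
    is asserted for each component and one component must hold all four points.\<close>
  have accelerated: "(\<forall>j\<in>{1..4}. x j \<in> h) \<and>
      (\<forall>B\<in>components h. constant_acceleration_world_line (\<bar>Nm\<bar> / L\<^sup>2) B) \<and>
      (\<exists>B\<in>components h. \<forall>j\<in>{1..4}. x j \<in> B)"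
    if "Nm \<noteq> 0" and h: "h = {y. - (lcbar y - L * (Nbar / Nm)) * (lc y - L * (N / Nm)) = (L\<^sup>2 / \<bar>Nm\<bar>)\<^sup>2}" for h
  proof -
    define r where "r = L\<^sup>2 / \<bar>Nm\<bar>"
    define t0 where "t0 = (L * (N / Nm) + L * (Nbar / Nm)) / 2"
    define x0 where "x0 = (L * (N / Nm) - L * (Nbar / Nm)) / 2"
    have r: "r > 0" "1 / r = \<bar>Nm\<bar> / L\<^sup>2" using assms(1) \<open>Nm \<noteq> 0\<close> by (simp_all add: r_def)
    have "h = {y. (snd y - x0)\<^sup>2 = r\<^sup>2 + (fst y - t0)\<^sup>2}"
      unfolding h t0_def x0_def r_def by (rule hyperbola_light_cone)
    then have comps: "components h = {hyperbola_branch r t0 x0 1, hyperbola_branch r t0 x0 (- 1)}"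
      using components_hyperbola[OF r(1)] by simp
    have on_h: "x j \<in> h" if "j \<in> {1..4}" for j
    proof -
      define b where "b = lcbar (x j)"
      define a where "a = lc (x j)"
      have "Nm\<^sup>2 * (- (b - L * (Nbar / Nm)) * (a - L * (N / Nm)))
          = - ((Nm * b - L * Nbar) * (Nm * a - L * N))"
        using \<open>Nm \<noteq> 0\<close> by (simp add: power2_eq_square algebra_simps)
      \<comment> \<open>Expanding the product, the curve equation replaces the terms containing
        \<open>a\<close> or \<open>b\<close> by \<open>- Nm * Np * L\<^sup>2\<close>; with
        \<open>L\<^sup>2 * N * Nbar\<close> this is \<open>- L\<^sup>2\<close> times the
        norm.\<close>
      also have "\<dots> = L\<^sup>2 * L\<^sup>2"
        using eq[OF that, folded a_def b_def] norm by algebra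
      finally have "- (b - L * (Nbar / Nm)) * (a - L * (N / Nm)) = L\<^sup>2 * L\<^sup>2 / Nm\<^sup>2"
        using \<open>Nm \<noteq> 0\<close> by (metis nonzero_mult_div_cancel_left power_not_zero)
      then show ?thesis
        by (simp add: h a_def b_def power_divide power2_eq_square)
    qed
    have ex_branch: "\<exists>s. s * s = 1 \<and> x j \<in> hyperbola_branch r t0 x0 s" if "j \<in> {1..4}" for j
    proof -
      have "x j \<in> \<Union> (components h)" using on_h[OF that] by simp
      then have "x j \<in> hyperbola_branch r t0 x0 1 \<or> x j \<in> hyperbola_branch r t0 x0 (- 1)" by (simp add: comps)
      then show ?thesis by (metis mult_1 mult_minus1 minus_minus)
    qed
    obtain s where s: "\<And>j. j \<in> {1..4} \<Longrightarrow> s j * s j = 1 \<and> x j \<in> hyperbola_branch r t0 x0 (s j)"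
      using that[of "\<lambda>j. SOME s. s * s = 1 \<and> x j \<in> hyperbola_branch r t0 x0 s"] someI_ex[OF ex_branch] by blast
    have s_eq: "s i = s j" if "i \<in> {1..4}" "j \<in> {1..4}" "inner11 (x i - x j) (x i - x j) < 0" for i j
      using timelike_separated_imp_same_branch s[OF that(1)] s[OF that(2)] that(3) by blast
    \<comment> \<open>The chain of neighbours 1, 2, 3, 4 transports the branch sign to every
      boundary point.\<close>
    have "s 1 = s 2" "s 2 = s 3" "s 3 = s 4"
      using timelike by (auto intro: s_eq)
    then have "s j = s 1" if "j \<in> {1..4}" for j
    proof -
      have "j = 1 \<or> j = 2 \<or> j = 3 \<or> j = 4" using that by auto
      with \<open>s 1 = s 2\<close> \<open>s 2 = s 3\<close> \<open>s 3 = s 4\<close> show ?thesis by fastforce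
    qed
    then have "\<forall>j\<in>{1..4}. x j \<in> hyperbola_branch r t0 x0 (s 1)" using s by metis
    moreover have "s 1 = 1 \<or> s 1 = - 1" using s[of 1] by (simp add: square_eq_1_iff)
    then have "hyperbola_branch r t0 x0 (s 1) \<in> components h" by (auto simp: comps)
    moreover have "\<forall>B\<in>components h. constant_acceleration_world_line (\<bar>Nm\<bar> / L\<^sup>2) B"
      using hyperbola_branch_world_line[OF r(1)] by (simp add: comps flip: r(2))
    ultimately show ?thesis using on_h by blast
  qed
  show ?thesis
    unfolding Let_def
    using norm eq inertial[OF _ refl] accelerated[OF _ refl]
    unfolding x_def Np_def Nm_def N_def Nbar_def n_def by blast
qed

end
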